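(* Let $T$ be an attack-defence tree and $\llbracket T\rrbracket$ its encoding in the rewrite theory $\mathcal{R}_{ADT}$ described in the context. If $n$ agents can perform an attack on $T$ with time $t$, then there exist $a$, $SA$ and $SD$ such that $\mathcal{R}_{ADT} \vdash \llbracket T\rrbracket \to^{*} [a,t,SA,SD]$ and $n \le a$.
   Context: An attack-defence tree (ADTree) $T$ is a tree whose leaves are attack actions (each with a time and a cost) or defence actions, and whose inner nodes are gates: OR (unordered children, succeeds iff some child succeeds), AND (unordered children in parallel, succeeds iff all succeed), SAND (ordered children executed sequentially), and NOT (single child, succeeds iff the child fails; encodes counter-defence gates). Gates may carry their own time and cost. Agents are interchangeable workers, each executing at most one action at a time; an attack on $T$ with time $t$ performed by $n$ agents is a schedule of the required actions among $n$ agents achieving the root within total time $t$. Rewrite theory $\mathcal{R}_{ADT}$: each node is an object with attributes time, cost, agents (1 for attack leaves, 0 for gates), accumulated time acctime and cost (initially 0), a set used, its children, and a status in $\{\mathrm{Unknown},\mathrm{Succeed},\mathrm{Fail}\}$ initially Unknown; $\llbracket T\rrbracket=\{Q;Cnf\}$ with $Q$ the root and $Cnf$ the multiset of node objects. Rules: Unknown attack/defence leaves may become Succeed or Fail. OR: a Succeed pending child $o$ makes the Unknown gate Succeed, empties its pending children, records $o$ in used, sets acctime/cost to the gate's own plus $o$'s accumulated values and agents to $o$'s; Fail children are removed; no pending children makes it Fail. AND: Succeed children are removed from pending and recorded, acctime combined by max and agents by sum; a Fail child makes it Fail; no pending children makes it Succeed. SAND: a Succeed first child is removed and recorded, acctime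 combined by sum and agents by max; failing first child gives Fail; empty list gives Succeed. NOT: child Succeed gives Fail, child Fail gives Succeed. END: when the root is Succeed, $\{Q;Cnf\}$ rewrites to the summary term $[a,t,SA,SD]$ of the root's agents $a$, accumulated time $t$, the set $SA$ of used attacks and the set $SD$ of active defences. $\mathcal{R}\vdash u\to^{*}u'$ means $u$ rewrites to $u'$ in zero or more steps. *)

theory Defs
  imports Main
begin

text \<open>Attack leaves carry a time and a cost; defence leaves carry nothing;
  gates (OR, AND, SAND, NOT) carry their own time and cost (first two nat
  arguments: time, cost).\<close>

datatype adt =
    ALeaf nat nat
  | DLeaf
  | OrG nat nat "adt list"
  | AndG nat nat "adt list"
  | SandG nat nat "adt list"
  | NotG nat nat adt

text \<open>Nodes are identified by their position (path from the root); the
  i-th child of the node at position p has position p @ [i].\<close>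

type_synonym pos = "nat list"

text \<open>out p says whether the leaf at position p is performed (attack) /
  active (defence).  sat / unsat: the subtree located at position p
  succeeds / fails.\<close>

inductive sat :: "adt \<Rightarrow> (pos \<Rightarrow> bool) \<Rightarrow> pos \<Rightarrow> bool"
  and unsat :: "adt \<Rightarrow> (pos \<Rightarrow> bool) \<Rightarrow> pos \<Rightarrow> bool"
  where
  sA: "out p \<Longrightarrow> sat (ALeaf tm c) out p"
| uA: "\<not> out p \<Longrightarrow> unsat (ALeaf tm c) out p"
| sD: "out p \<Longrightarrow> sat DLeaf out p"
| uD: "\<not> out p \<Longrightarrow> unsat DLeaf out p"
| sOr: "i < length cs \<Longrightarrow> sat (cs ! i) out (p @ [i]) \<Longrightarrow> sat (OrG g c cs) out p"
| uOr: "\<forall>i < length cs. unsat (cs ! i) out (p @ [i]) \<Longrightarrow> unsat (OrG g c cs) out p"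
| sAnd: "\<forall>i < length cs. sat (cs ! i) out (p @ [i]) \<Longrightarrow> sat (AndG g c cs) out p"
| uAnd: "i < length cs \<Longrightarrow> unsat (cs ! i) out (p @ [i]) \<Longrightarrow> unsat (AndG g c cs) out p"
| sSand: "\<forall>i < length cs. sat (cs ! i) out (p @ [i]) \<Longrightarrow> sat (SandG g c cs) out p"
| uSand: "i < length cs \<Longrightarrow> unsat (cs ! i) out (p @ [i]) \<Longrightarrow> unsat (SandG g c cs) out p"
| sNot: "unsat t out (p @ [0]) \<Longrightarrow> sat (NotG g c t) out p"
| uNot: "sat t out (p @ [0]) \<Longrightarrow> unsat (NotG g c t) out p"

text \<open>exec T out p s J f: under leaf outcome out, the subtree T located at
  position p is achieved when started at time s, by executing the set J of
  required attack actions, each recorded as (position, start time, finish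
  time), and it is achieved at time f.\<close>

inductive exec :: "adt \<Rightarrow> (pos \<Rightarrow> bool) \<Rightarrow> pos \<Rightarrow> nat \<Rightarrow> (pos \<times> nat \<times> nat) set \<Rightarrow> nat \<Rightarrow> bool"
  where
  eA: "out p \<Longrightarrow> exec (ALeaf tm c) out p s {(p, s, s + tm)} (s + tm)"
| eD: "out p \<Longrightarrow> exec DLeaf out p s {} s"
| eOr: "i < length cs \<Longrightarrow> exec (cs ! i) out (p @ [i]) s J f
        \<Longrightarrow> exec (OrG g c cs) out p s J (f + g)"
| eAnd: "\<forall>i < length cs. exec (cs ! i) out (p @ [i]) s (JJ i) (ff i)
        \<Longrightarrow> exec (AndG g c cs) out p s (\<Union>i < length cs. JJ i)
              (Max (insert s (ff ` {..<length cs})) + g)"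
| eSand: "st 0 = s \<Longrightarrow>
        \<forall>i < length cs. exec (cs ! i) out (p @ [i]) (st i) (JJ i) (st (Suc i))
        \<Longrightarrow> exec (SandG g c cs) out p s (\<Union>i < length cs. JJ i) (st (length cs) + g)"
| eNot: "unsat t out (p @ [0]) \<Longrightarrow> exec (NotG g c t) out p s {} (s + g)"

definition fits :: "(pos \<times> nat \<times> nat) set \<Rightarrow> nat \<Rightarrow> bool" where
  "fits J n \<longleftrightarrow> (\<exists>ag :: pos \<times> nat \<times> nat \<Rightarrow> nat.
      (\<forall>j \<in> J. ag j < n) \<and>
      (\<forall>j1 \<in> J. \<forall>j2 \<in> J. j1 \<noteq> j2 \<and> ag j1 = ag j2 \<longrightarrow>
          snd (snd j1) \<le> fst (snd j2) \<or> snd (snd j2) \<le> fst (snd j1)))"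

text \<open>n agents can perform an attack on T with time t: some attack on T
  (leaf outcome and schedule of its required actions, starting at time 0)
  achieves the root at time t, and n is the number of agents it needs
  (its actions fit on n agents but not on fewer).\<close>

definition can_perform :: "adt \<Rightarrow> nat \<Rightarrow> nat \<Rightarrow> bool" where
  "can_perform T n t \<longleftrightarrow> (\<exists>out J. exec T out [] 0 J t \<and> fits J n \<and> (\<forall>m < n. \<not> fits J m))"

datatype kind = KAtk | KDef | KOr | KAnd | KSand | KNot

datatype status = Unknown | Succeed | Fail

record obj =
  kind :: kind
  otime :: nat
  ocost :: nat
  agents :: nat
  acctime :: nat
  acccost :: nat
  used :: "pos set"
  pend :: "pos list"
  status :: status

text \<open>Terms: a configuration {Q; Cnf} (root identifier and the node objects,
  given as a finite map from identifiers to objects), or a summary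
  [a, t, SA, SD].\<close>

datatype rterm =
    Conf pos "pos \<Rightarrow> obj option"
  | Summary nat nat "pos set" "pos set"

fun node_at :: "adt \<Rightarrow> pos \<Rightarrow> adt option" where
  "node_at T [] = Some T"
| "node_at (OrG g c cs) (i # q) = (if i < length cs then node_at (cs ! i) q else None)"
| "node_at (AndG g c cs) (i # q) = (if i < length cs then node_at (cs ! i) q else None)"
| "node_at (SandG g c cs) (i # q) = (if i < length cs then node_at (cs ! i) q else None)"
| "node_at (NotG g c t) (i # q) = (if i = 0 then node_at t q else None)"
| "node_at _ (i # q) = None"

fun init_obj :: "pos \<Rightarrow> adt \<Rightarrow> obj" where
  "init_obj p (ALeaf tm c) = \<lparr>kind = KAtk, otime = tm, ocost = c, agents = 1, acctime = 0,
      acccost = 0, used = {}, pend = [], status = Unknown\<rparr>"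
| "init_obj p DLeaf = \<lparr>kind = KDef, otime = 0, ocost = 0, agents = 0, acctime = 0,
      acccost = 0, used = {}, pend = [], status = Unknown\<rparr>"
| "init_obj p (OrG g c cs) = \<lparr>kind = KOr, otime = g, ocost = c, agents = 0, acctime = 0,
      acccost = 0, used = {}, pend = map (\<lambda>i. p @ [i]) [0..<length cs], status = Unknown\<rparr>"
| "init_obj p (AndG g c cs) = \<lparr>kind = KAnd, otime = g, ocost = c, agents = 0, acctime = 0,
      acccost = 0, used = {}, pend = map (\<lambda>i. p @ [i]) [0..<length cs], status = Unknown\<rparr>"
| "init_obj p (SandG g c cs) = \<lparr>kind = KSand, otime = g, ocost = c, agents = 0, acctime = 0,
      acccost = 0, used = {}, pend = map (\<lambda>i. p @ [i]) [0..<length cs], status = Unknown\<rparr>"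
| "init_obj p (NotG g c t) = \<lparr>kind = KNot, otime = g, ocost = c, agents = 0, acctime = 0,
      acccost = 0, used = {}, pend = [p @ [0]], status = Unknown\<rparr>"

definition encode :: "adt \<Rightarrow> rterm" where
  "encode T = Conf [] (\<lambda>p. map_option (init_obj p) (node_at T p))"

definition used_attacks :: "pos \<Rightarrow> (pos \<Rightarrow> obj option) \<Rightarrow> pos set" where
  "used_attacks r M = {q. (r, q) \<in> {(x, y). \<exists>ob. M x = Some ob \<and> y \<in> used ob}\<^sup>*
                          \<and> (\<exists>ob. M q = Some ob \<and> kind ob = KAtk)}"

definition active_defences :: "(pos \<Rightarrow> obj option) \<Rightarrow> pos set" where
  "active_defences M = {q. \<exists>ob. M q = Some ob \<and> kind ob = KDef \<and> status ob = Succeed}"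

inductive step :: "rterm \<Rightarrow> rterm \<Rightarrow> bool" where
  leaf_succ: "M p = Some ob \<Longrightarrow> kind ob \<in> {KAtk, KDef} \<Longrightarrow> status ob = Unknown \<Longrightarrow>
     step (Conf r M) (Conf r (M(p \<mapsto> ob\<lparr>status := Succeed, acctime := otime ob, acccost := ocost ob\<rparr>)))"
| leaf_fail: "M p = Some ob \<Longrightarrow> kind ob \<in> {KAtk, KDef} \<Longrightarrow> status ob = Unknown \<Longrightarrow>
     step (Conf r M) (Conf r (M(p \<mapsto> ob\<lparr>status := Fail\<rparr>)))"
| or_succ: "M p = Some ob \<Longrightarrow> kind ob = KOr \<Longrightarrow> status ob = Unknown \<Longrightarrow> c \<in> set (pend ob) \<Longrightarrow>
     M c = Some oc \<Longrightarrow> status oc = Succeed \<Longrightarrow>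
     step (Conf r M) (Conf r (M(p \<mapsto> ob\<lparr>status := Succeed, pend := [], used := used ob \<union> {c},
        acctime := otime ob + acctime oc, acccost := ocost ob + acccost oc, agents := agents oc\<rparr>)))"
| or_rem: "M p = Some ob \<Longrightarrow> kind ob = KOr \<Longrightarrow> status ob = Unknown \<Longrightarrow> c \<in> set (pend ob) \<Longrightarrow>
     M c = Some oc \<Longrightarrow> status oc = Fail \<Longrightarrow>
     step (Conf r M) (Conf r (M(p \<mapsto> ob\<lparr>pend := removeAll c (pend ob)\<rparr>)))"
| or_fail: "M p = Some ob \<Longrightarrow> kind ob = KOr \<Longrightarrow> status ob = Unknown \<Longrightarrow> pend ob = [] \<Longrightarrow>
     step (Conf r M) (Conf r (M(p \<mapsto> ob\<lparr>status := Fail\<rparr>)))"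
| and_child: "M p = Some ob \<Longrightarrow> kind ob = KAnd \<Longrightarrow> status ob = Unknown \<Longrightarrow> c \<in> set (pend ob) \<Longrightarrow>
     M c = Some oc \<Longrightarrow> status oc = Succeed \<Longrightarrow>
     step (Conf r M) (Conf r (M(p \<mapsto> ob\<lparr>pend := removeAll c (pend ob), used := used ob \<union> {c},
        acctime := max (acctime ob) (acctime oc), acccost := acccost ob + acccost oc,
        agents := agents ob + agents oc\<rparr>)))"
| and_fail: "M p = Some ob \<Longrightarrow> kind ob = KAnd \<Longrightarrow> status ob = Unknown \<Longrightarrow> c \<in> set (pend ob) \<Longrightarrow>
     M c = Some oc \<Longrightarrow> status oc = Fail \<Longrightarrow>
     step (Conf r M) (Conf r (M(p \<mapsto> ob\<lparr>status := Fail\<rparr>)))"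
| and_succ: "M p = Some ob \<Longrightarrow> kind ob = KAnd \<Longrightarrow> status ob = Unknown \<Longrightarrow> pend ob = [] \<Longrightarrow>
     step (Conf r M) (Conf r (M(p \<mapsto> ob\<lparr>status := Succeed,
        acctime := acctime ob + otime ob, acccost := acccost ob + ocost ob\<rparr>)))"
| sand_child: "M p = Some ob \<Longrightarrow> kind ob = KSand \<Longrightarrow> status ob = Unknown \<Longrightarrow> pend ob = c # cs \<Longrightarrow>
     M c = Some oc \<Longrightarrow> status oc = Succeed \<Longrightarrow>
     step (Conf r M) (Conf r (M(p \<mapsto> ob\<lparr>pend := cs, used := used ob \<union> {c},
        acctime := acctime ob + acctime oc, acccost := acccost ob + acccost oc,
        agents := max (agents ob) (agents oc)\<rparr>)))"
| sand_fail: "M p = Some ob \<Longrightarrow> kind ob = KSand \<Longrightarrow> status ob = Unknown \<Longrightarrow> pend ob = c # cs \<Longrightarrow>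
     M c = Some oc \<Longrightarrow> status oc = Fail \<Longrightarrow>
     step (Conf r M) (Conf r (M(p \<mapsto> ob\<lparr>status := Fail\<rparr>)))"
| sand_succ: "M p = Some ob \<Longrightarrow> kind ob = KSand \<Longrightarrow> status ob = Unknown \<Longrightarrow> pend ob = [] \<Longrightarrow>
     step (Conf r M) (Conf r (M(p \<mapsto> ob\<lparr>status := Succeed,
        acctime := acctime ob + otime ob, acccost := acccost ob + ocost ob\<rparr>)))"
| not_fail: "M p = Some ob \<Longrightarrow> kind ob = KNot \<Longrightarrow> status ob = Unknown \<Longrightarrow> pend ob = [c] \<Longrightarrow>
     M c = Some oc \<Longrightarrow> status oc = Succeed \<Longrightarrow>
     step (Conf r M) (Conf r (M(p \<mapsto> ob\<lparr>status := Fail\<rparr>)))"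
| not_succ: "M p = Some ob \<Longrightarrow> kind ob = KNot \<Longrightarrow> status ob = Unknown \<Longrightarrow> pend ob = [c] \<Longrightarrow>
     M c = Some oc \<Longrightarrow> status oc = Fail \<Longrightarrow>
     step (Conf r M) (Conf r (M(p \<mapsto> ob\<lparr>status := Succeed,
        acctime := otime ob, acccost := ocost ob\<rparr>)))"
| finish: "M r = Some ob \<Longrightarrow> status ob = Succeed \<Longrightarrow>
     step (Conf r M) (Summary (agents ob) (acctime ob) (used_attacks r M) (active_defences M))"

abbreviation rewrites_to :: "rterm \<Rightarrow> rterm \<Rightarrow> bool" (infix "\<rightarrow>\<^sup>*" 50) where
  "u \<rightarrow>\<^sup>* u' \<equiv> step\<^sup>*\<^sup>* u u'"

end

theory Submission
  imports Defs "HOL-Library.Sublist"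
begin

(* By induction on the derivation of the attack, the
   subtree at a position p can be rewritten, changing only objects at positions below p, until the
   object at p is Succeed, its accumulated time is the time the subtree needs, and its agents
   value is a number of agents on which the subtree's actions can be scheduled: the children of
   an AND gate run in parallel on disjoint pools of agents, those of a SAND gate one after the
   other on a common pool.  A NOT gate needs its child to fail, and every subtree that fails under
   the leaf outcome can indeed be rewritten to Fail.  Since the attack needs at least n agents, the
   agents value at the root is at least n. *)

section \<open>Schedules\<close>

abbreviation start_time :: "pos \<times> nat \<times> nat \<Rightarrow> nat" where
  "start_time j \<equiv> fst (snd j)"

abbreviation finish_time :: "pos \<times> nat \<times> nat \<Rightarrow> nat" where
  "finish_time j \<equiv> snd (snd j)"

lemma fits_mono: "fits J a \<Longrightarrow> a \<le> b \<Longrightarrow> fits J b"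
  unfolding fits_def using order_less_le_trans by blast

lemma fits_empty: "fits {} m"
  unfolding fits_def by simp

lemma fits_singleton: "fits {j} 1"
  unfolding fits_def by (intro exI[of _ "\<lambda>_. 0"]) simp

lemma fits_Un_add:
  assumes "fits A a" and "fits B b"
  shows "fits (A \<union> B) (a + b)"
proof -
  obtain agA agB where
    A: "\<forall>j\<in>A. agA j < a" "\<forall>j1\<in>A. \<forall>j2\<in>A. j1 \<noteq> j2 \<and> agA j1 = agA j2 \<longrightarrow>
          finish_time j1 \<le> start_time j2 \<or> finish_time j2 \<le> start_time j1" and
    B: "\<forall>j\<in>B. agB j < b" "\<forall>j1\<in>B. \<forall>j2\<in>B. j1 \<noteq> j2 \<and> agB j1 = agB j2 \<longrightarrow>
          finish_time j1 \<le> start_time j2 \<or> finish_time j2 \<le> start_time j1"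
    using assms unfolding fits_def by blast
  define ag where "ag j = (if j \<in> A then agA j else a + agB j)" for j
  show ?thesis
    unfolding fits_def
  proof (intro exI[of _ ag] conjI ballI impI)
    fix j assume "j \<in> A \<union> B"
    then show "ag j < a + b" using A(1) B(1) by (auto simp: ag_def)
  next
    fix j1 j2 assume j: "j1 \<in> A \<union> B" "j2 \<in> A \<union> B" "j1 \<noteq> j2 \<and> ag j1 = ag j2"
    then consider "j1 \<in> A" "j2 \<in> A" | "j1 \<in> B - A" "j2 \<in> B - A"
      using A(1) by (auto simp: ag_def split: if_splits)
    then show "finish_time j1 \<le> start_time j2 \<or> finish_time j2 \<le> start_time j1"
      by cases (use A(2) B(2) j in \<open>auto simp: ag_def\<close>)
  qed
qed

lemma fits_Un_sequential:
  assumes "fits A m" and "fits B m"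
    and "\<And>j j'. j \<in> A \<Longrightarrow> j' \<in> B \<Longrightarrow> finish_time j \<le> start_time j'"
  shows "fits (A \<union> B) m"
proof -
  obtain agA agB where
    A: "\<forall>j\<in>A. agA j < m" "\<forall>j1\<in>A. \<forall>j2\<in>A. j1 \<noteq> j2 \<and> agA j1 = agA j2 \<longrightarrow>
          finish_time j1 \<le> start_time j2 \<or> finish_time j2 \<le> start_time j1" and
    B: "\<forall>j\<in>B. agB j < m" "\<forall>j1\<in>B. \<forall>j2\<in>B. j1 \<noteq> j2 \<and> agB j1 = agB j2 \<longrightarrow>
          finish_time j1 \<le> start_time j2 \<or> finish_time j2 \<le> start_time j1"
    using assms(1,2) unfolding fits_def by blast
  define ag where "ag j = (if j \<in> A then agA j else agB j)" for j
  show ?thesis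
    unfolding fits_def
  proof (intro exI[of _ ag] conjI ballI impI)
    fix j assume "j \<in> A \<union> B"
    then show "ag j < m" using A(1) B(1) by (auto simp: ag_def)
  next
    fix j1 j2 assume j: "j1 \<in> A \<union> B" "j2 \<in> A \<union> B" "j1 \<noteq> j2 \<and> ag j1 = ag j2"
    then consider "j1 \<in> A" "j2 \<in> A" | "j1 \<in> B - A" "j2 \<in> B - A" | "j1 \<in> A" "j2 \<in> B" | "j1 \<in> B" "j2 \<in> A"
      by blast
    then show "finish_time j1 \<le> start_time j2 \<or> finish_time j2 \<le> start_time j1"
      by cases (use A(2) B(2) j assms(3) in \<open>auto simp: ag_def\<close>)
  qed
qed

lemma fits_UN_sum:
  fixes n :: nat
  shows "(\<And>i. i < n \<Longrightarrow> fits (JJ i) (a i)) \<Longrightarrow> fits (\<Union>i<n. JJ i) (\<Sum>i<n. a i)"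
proof (induction n)
  case 0
  show ?case using fits_empty by simp
next
  case (Suc n)
  then have "fits ((\<Union>i<n. JJ i) \<union> JJ n) ((\<Sum>i<n. a i) + a n)"
    by (intro fits_Un_add) auto
  then show ?case by (simp add: lessThan_Suc Un_commute add.commute)
qed

lemma fits_UN_sequential:
  fixes n :: nat
  assumes "\<And>i. i < n \<Longrightarrow> fits (JJ i) m"
    and "\<And>i k j j'. i < k \<Longrightarrow> k < n \<Longrightarrow> j \<in> JJ i \<Longrightarrow> j' \<in> JJ k \<Longrightarrow> finish_time j \<le> start_time j'"
  shows "fits (\<Union>i<n. JJ i) m"
  using assms
proof (induction n)
  case 0
  show ?case using fits_empty by simp
next
  case (Suc n)
  have "fits ((\<Union>i<n. JJ i) \<union> JJ n) m"
    by (rule fits_Un_sequential) (use Suc in auto)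
  then show ?case by (simp add: lessThan_Suc Un_commute)
qed

lemma exec_interval:
  "exec T out p s J f \<Longrightarrow> s \<le> f \<and> (\<forall>j\<in>J. s \<le> start_time j \<and> finish_time j \<le> f)"
proof (induction rule: exec.induct)
  case (eAnd cs out p s JJ ff g c)
  let ?m = "Max (insert s (ff ` {..<length cs}))"
  show ?case
  proof (intro conjI ballI)
    show "s \<le> ?m + g" by (simp add: trans_le_add1)
  next
    fix j assume "j \<in> (\<Union>i<length cs. JJ i)"
    then obtain i where i: "i < length cs" "j \<in> JJ i" by blast
    then have "s \<le> start_time j" "finish_time j \<le> ff i" using eAnd.IH by blast+
    moreover have "ff i \<le> ?m" using i(1) by simp
    ultimately show "s \<le> start_time j" "finish_time j \<le> ?m + g" by linarith+
  qed
next
  case (eSand st s cs out p JJ g c)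
  have mono: "st i \<le> st k" if "i \<le> k" "k \<le> length cs" for i k
    by (rule lift_Suc_mono_le_ivl[of "{..<length cs}"]) (use eSand that in auto)
  show ?case
  proof (intro conjI ballI)
    show "s \<le> st (length cs) + g" using mono[of 0 "length cs"] eSand.hyps by simp
  next
    fix j assume "j \<in> (\<Union>i<length cs. JJ i)"
    then obtain i where i: "i < length cs" "j \<in> JJ i" by blast
    then have "st i \<le> start_time j" "finish_time j \<le> st (Suc i)" using eSand.IH by blast+
    moreover have "s \<le> st i" "st (Suc i) \<le> st (length cs)"
      using mono[of 0 i] mono[of "Suc i" "length cs"] i(1) eSand.hyps by simp_all
    ultimately show "s \<le> start_time j" "finish_time j \<le> st (length cs) + g" by linarith+
  qed
qed auto

lemma sum_increments:
  fixes st d :: "nat \<Rightarrow> 'a::comm_monoid_add"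
  shows "(\<And>i. i < n \<Longrightarrow> st (Suc i) = st i + d i) \<Longrightarrow> st n = st 0 + (\<Sum>i<n. d i)"
  by (induction n) (simp_all add: add.assoc)

lemma Max_insert_max:
  fixes A :: "'a::linorder set"
  assumes "finite A"
  shows "Max (insert (max a b) A) = Max (insert a (insert b A))"
  using assms by (cases "A = {}") (auto simp: Max_insert max.assoc)

section \<open>Boolean outcome of a tree\<close>

lemma sat_or_unsat: "sat T out p \<or> unsat T out p"
proof (induction T arbitrary: p)
  case (ALeaf tm c)
  show ?case by (cases "out p") (auto intro: sat_unsat.intros)
next
  case DLeaf
  show ?case by (cases "out p") (auto intro: sat_unsat.intros)
next
  case (OrG g c cs)
  show ?case
  proof (cases "\<exists>i<length cs. sat (cs ! i) out (p @ [i])")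
    case True
    then show ?thesis by (auto intro: sat_unsat.intros)
  next
    case False
    then have "\<forall>i<length cs. unsat (cs ! i) out (p @ [i])"
      using OrG.IH nth_mem by blast
    then show ?thesis by (auto intro: sat_unsat.intros)
  qed
next
  case (AndG g c cs)
  then show ?case
    by (cases "\<exists>i<length cs. unsat (cs ! i) out (p @ [i])") (auto intro: sat_unsat.intros nth_mem)
next
  case (SandG g c cs)
  then show ?case
    by (cases "\<exists>i<length cs. unsat (cs ! i) out (p @ [i])") (auto intro: sat_unsat.intros nth_mem)
next
  case (NotG g c t)
  then show ?case by (auto intro: sat_unsat.intros)
qed

inductive_cases sat_OrE: "sat (OrG g c cs) out p"
inductive_cases unsat_OrE: "unsat (OrG g c cs) out p"
inductive_cases sat_AndE: "sat (AndG g c cs) out p"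
inductive_cases unsat_AndE: "unsat (AndG g c cs) out p"
inductive_cases sat_SandE: "sat (SandG g c cs) out p"
inductive_cases unsat_SandE: "unsat (SandG g c cs) out p"
inductive_cases sat_NotE: "sat (NotG g c t) out p"
inductive_cases unsat_NotE: "unsat (NotG g c t) out p"

lemma unsat_SandE_first:
  assumes "unsat (SandG g c cs) out p"
  obtains j where "j < length cs" "unsat (cs ! j) out (p @ [j])" "\<forall>i<j. sat (cs ! i) out (p @ [i])"
proof -
  have "\<exists>j. j < length cs \<and> unsat (cs ! j) out (p @ [j])"
    using assms by (blast elim: unsat_SandE)
  then show ?thesis
    using that exists_least_iff[where P = "\<lambda>j. j < length cs \<and> unsat (cs ! j) out (p @ [j])"]
      sat_or_unsat by (metis order.strict_trans)
qed

section \<open>Rewriting confined to a subtree\<close>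

definition encodes_at :: "adt \<Rightarrow> pos \<Rightarrow> (pos \<Rightarrow> obj option) \<Rightarrow> bool" where
  "encodes_at T p M \<longleftrightarrow> (\<forall>q. M (p @ q) = map_option (init_obj (p @ q)) (node_at T q))"

lemma encodes_at_root: "encodes_at T p M \<Longrightarrow> M p = Some (init_obj p T)"
  unfolding encodes_at_def by (metis append_Nil2 node_at.simps(1) option.simps(9))

lemma node_at_Cons: "node_at T [i] = Some t \<Longrightarrow> node_at T (i # q) = node_at t q"
  by (cases T) (auto split: if_splits)

lemma encodes_at_child:
  assumes "encodes_at T p M" and "node_at T [i] = Some t"
  shows "encodes_at t (p @ [i]) M"
  unfolding encodes_at_def
proof
  fix q
  have "M (p @ i # q) = map_option (init_obj (p @ i # q)) (node_at T (i # q))"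
    using assms(1) unfolding encodes_at_def by blast
  then show "M ((p @ [i]) @ q) = map_option (init_obj ((p @ [i]) @ q)) (node_at t q)"
    using node_at_Cons[OF assms(2)] by simp
qed

lemma encodes_at_cong:
  "encodes_at T p M \<Longrightarrow> (\<And>x. prefix p x \<Longrightarrow> M' x = M x) \<Longrightarrow> encodes_at T p M'"
  unfolding encodes_at_def by simp

lemma prefix_sibling: "prefix (p @ [i]) x \<Longrightarrow> prefix (p @ [k]) x \<Longrightarrow> i = k"
  unfolding prefix_def by auto

lemma distinct_child_positions: "distinct (map (\<lambda>i. p @ [i]) [a..<b])"
  by (auto simp: distinct_map inj_on_def)

context
  fixes r :: pos
begin

definition run_within :: "pos \<Rightarrow> (pos \<Rightarrow> obj option) \<Rightarrow> (pos \<Rightarrow> obj option) \<Rightarrow> bool" where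
  "run_within p M M' \<longleftrightarrow> Conf r M \<rightarrow>\<^sup>* Conf r M' \<and> (\<forall>x. \<not> prefix p x \<longrightarrow> M' x = M x)"

definition reaches_at :: "pos \<Rightarrow> (pos \<Rightarrow> obj option) \<Rightarrow> (obj \<Rightarrow> bool) \<Rightarrow> bool" where
  "reaches_at p M Q \<longleftrightarrow> (\<exists>M' ob. run_within p M M' \<and> M' p = Some ob \<and> Q ob)"

lemma reaches_at_update:
  assumes "run_within p M M1" and "Conf r M1 \<rightarrow>\<^sup>* Conf r (M1(p \<mapsto> ob))" and "Q ob"
  shows "reaches_at p M Q"
  using assms unfolding reaches_at_def run_within_def
  by (intro exI[of _ "M1(p \<mapsto> ob)"] exI[of _ ob]) (auto intro: rtranclp_trans)

lemma reaches_at_mono: "reaches_at p M Q \<Longrightarrow> (\<And>ob. Q ob \<Longrightarrow> Q' ob) \<Longrightarrow> reaches_at p M Q'"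
  unfolding reaches_at_def by blast

lemma leaf_reaches:
  assumes "M p = Some ob" and "kind ob \<in> {KAtk, KDef}" and "status ob = Unknown"
  shows "reaches_at p M (\<lambda>ob'. status ob' = Succeed \<and> acctime ob' = otime ob \<and> agents ob' = agents ob)"
    and "reaches_at p M (\<lambda>ob'. status ob' = Fail)"
proof -
  have run: "run_within p M M" by (simp add: run_within_def)
  show "reaches_at p M (\<lambda>ob'. status ob' = Succeed \<and> acctime ob' = otime ob \<and> agents ob' = agents ob)"
    by (rule reaches_at_update[OF run r_into_rtranclp[where r=step, OF leaf_succ[of M p ob r, OF assms]]]) simp
  show "reaches_at p M (\<lambda>ob'. status ob' = Fail)"
    by (rule reaches_at_update[OF run r_into_rtranclp[where r=step, OF leaf_fail[of M p ob r, OF assms]]]) simp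
qed

lemma children_reach:
  assumes "encodes_at T p M" and "finite I"
    and child: "\<And>i. i \<in> I \<Longrightarrow> node_at T [i] = Some (ts i)"
    and reach: "\<And>i M. i \<in> I \<Longrightarrow> encodes_at (ts i) (p @ [i]) M \<Longrightarrow> reaches_at (p @ [i]) M (Q i)"
  shows "\<exists>M' oc. run_within p M M' \<and> M' p = Some (init_obj p T)
    \<and> (\<forall>i\<in>I. M' (p @ [i]) = Some (oc i) \<and> Q i (oc i))"
proof -
  \<comment> \<open>The children are rewritten one after the other; this frame, stronger than \<open>run_within p\<close>,
    keeps the subtrees of the children not yet processed in their initial state.\<close>
  have "\<exists>M' oc. Conf r M \<rightarrow>\<^sup>* Conf r M' \<and> (\<forall>x. (\<forall>i\<in>I. \<not> prefix (p @ [i]) x) \<longrightarrow> M' x = M x)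
    \<and> (\<forall>i\<in>I. M' (p @ [i]) = Some (oc i) \<and> Q i (oc i))"
    using assms(2) child reach
  proof (induction I rule: finite_induct)
    case empty
    show ?case by auto
  next
    case (insert k I)
    then obtain M1 oc where M1: "Conf r M \<rightarrow>\<^sup>* Conf r M1"
      "\<forall>x. (\<forall>i\<in>I. \<not> prefix (p @ [i]) x) \<longrightarrow> M1 x = M x"
      "\<forall>i\<in>I. M1 (p @ [i]) = Some (oc i) \<and> Q i (oc i)"
      by auto
    have "encodes_at (ts k) (p @ [k]) M"
      using encodes_at_child[OF assms(1)] insert.prems(1) by simp
    then have "encodes_at (ts k) (p @ [k]) M1"
      by (rule encodes_at_cong) (use M1(2) insert.hyps(2) prefix_sibling in metis)
    then obtain M2 ob where M2: "run_within (p @ [k]) M1 M2" "M2 (p @ [k]) = Some ob" "Q k ob"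
      using insert.prems(2) unfolding reaches_at_def by blast
    have siblings: "M2 (p @ [i]) = M1 (p @ [i])" if "i \<in> I" for i
      using M2(1) that insert.hyps(2) unfolding run_within_def by (metis prefix_sibling prefix_order.refl)
    show ?case
    proof (intro exI[of _ M2] exI[of _ "oc(k := ob)"] conjI)
      show "Conf r M \<rightarrow>\<^sup>* Conf r M2"
        using M1(1) M2(1) unfolding run_within_def by (auto intro: rtranclp_trans)
      show "\<forall>x. (\<forall>i\<in>insert k I. \<not> prefix (p @ [i]) x) \<longrightarrow> M2 x = M x"
        using M1(2) M2(1) unfolding run_within_def by auto
      show "\<forall>i\<in>insert k I. M2 (p @ [i]) = Some ((oc(k := ob)) i) \<and> Q i ((oc(k := ob)) i)"
        using M1(3) M2(2,3) siblings insert.hyps(2) by auto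
    qed
  qed
  then obtain M' oc where "Conf r M \<rightarrow>\<^sup>* Conf r M'"
    "\<forall>x. (\<forall>i\<in>I. \<not> prefix (p @ [i]) x) \<longrightarrow> M' x = M x"
    "\<forall>i\<in>I. M' (p @ [i]) = Some (oc i) \<and> Q i (oc i)"
    by blast
  moreover have "\<not> prefix (p @ [i]) x" if "\<not> prefix p x" for i x
    using that append_prefixD by blast
  ultimately show ?thesis
    unfolding run_within_def using encodes_at_root[OF assms(1)]
    by (intro exI[of _ M'] exI[of _ oc]) auto
qed

section \<open>Gate rules\<close>

lemma or_drop_failed:
  assumes "kind ob = KOr" and "status ob = Unknown" and "pend ob = ps" and "distinct ps" and "p \<notin> set ps"
    and "\<forall>c\<in>set ps. \<exists>oc. M c = Some oc \<and> status oc = Fail"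
  shows "\<exists>ob'. Conf r (M(p \<mapsto> ob)) \<rightarrow>\<^sup>* Conf r (M(p \<mapsto> ob'))
    \<and> kind ob' = KOr \<and> status ob' = Unknown \<and> pend ob' = []"
  using assms
proof (induction ps arbitrary: ob)
  case Nil
  then show ?case by auto
next
  case (Cons c cs)
  obtain oc where oc: "M c = Some oc" "status oc = Fail" "c \<noteq> p"
    using Cons.prems by auto
  have "removeAll c (pend ob) = cs"
    using Cons.prems(3,4) by simp
  then have "step (Conf r (M(p \<mapsto> ob))) (Conf r (M(p \<mapsto> ob\<lparr>pend := cs\<rparr>)))"
    using or_rem[of "M(p \<mapsto> ob)" p ob c oc r] oc Cons.prems by simp
  moreover have "\<exists>ob'. Conf r (M(p \<mapsto> ob\<lparr>pend := cs\<rparr>)) \<rightarrow>\<^sup>* Conf r (M(p \<mapsto> ob'))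
      \<and> kind ob' = KOr \<and> status ob' = Unknown \<and> pend ob' = []"
    by (rule Cons.IH) (use Cons.prems in simp_all)
  ultimately show ?case
    by (meson converse_rtranclp_into_rtranclp)
qed

lemma and_collect_succeeded:
  assumes "kind ob = KAnd" and "status ob = Unknown" and "pend ob = ps" and "distinct ps" and "p \<notin> set ps"
    and "\<forall>c\<in>set ps. \<exists>oc. M c = Some oc \<and> status oc = Succeed"
  shows "\<exists>ob'. Conf r (M(p \<mapsto> ob)) \<rightarrow>\<^sup>* Conf r (M(p \<mapsto> ob'))
    \<and> kind ob' = KAnd \<and> status ob' = Unknown \<and> pend ob' = [] \<and> otime ob' = otime ob
    \<and> acctime ob' = Max (insert (acctime ob) ((\<lambda>c. acctime (the (M c))) ` set ps))
    \<and> agents ob' = agents ob + (\<Sum>c\<leftarrow>ps. agents (the (M c)))"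
  using assms
proof (induction ps arbitrary: ob)
  case Nil
  then show ?case by (intro exI[of _ ob]) auto
next
  case (Cons c cs)
  obtain oc where oc: "M c = Some oc" "status oc = Succeed" "c \<noteq> p"
    using Cons.prems by auto
  define ob1 where "ob1 = ob\<lparr>pend := cs, used := used ob \<union> {c},
    acctime := max (acctime ob) (acctime oc), acccost := acccost ob + acccost oc,
    agents := agents ob + agents oc\<rparr>"
  have "removeAll c (pend ob) = cs"
    using Cons.prems(3,4) by simp
  then have step1: "step (Conf r (M(p \<mapsto> ob))) (Conf r (M(p \<mapsto> ob1)))"
    using and_child[of "M(p \<mapsto> ob)" p ob c oc r] oc Cons.prems by (simp add: ob1_def)
  have "\<exists>ob'. Conf r (M(p \<mapsto> ob1)) \<rightarrow>\<^sup>* Conf r (M(p \<mapsto> ob'))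
      \<and> kind ob' = KAnd \<and> status ob' = Unknown \<and> pend ob' = [] \<and> otime ob' = otime ob1
      \<and> acctime ob' = Max (insert (acctime ob1) ((\<lambda>c. acctime (the (M c))) ` set cs))
      \<and> agents ob' = agents ob1 + (\<Sum>c\<leftarrow>cs. agents (the (M c)))"
    by (rule Cons.IH) (use Cons.prems in \<open>simp_all add: ob1_def\<close>)
  then obtain ob' where ob': "Conf r (M(p \<mapsto> ob1)) \<rightarrow>\<^sup>* Conf r (M(p \<mapsto> ob'))"
    "kind ob' = KAnd" "status ob' = Unknown" "pend ob' = []" "otime ob' = otime ob1"
    "acctime ob' = Max (insert (acctime ob1) ((\<lambda>c. acctime (the (M c))) ` set cs))"
    "agents ob' = agents ob1 + (\<Sum>c\<leftarrow>cs. agents (the (M c)))"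
    by blast
  have "Conf r (M(p \<mapsto> ob)) \<rightarrow>\<^sup>* Conf r (M(p \<mapsto> ob'))"
    using step1 ob'(1) by (rule converse_rtranclp_into_rtranclp)
  moreover have "acctime ob' = Max (insert (acctime ob) ((\<lambda>c. acctime (the (M c))) ` set (c # cs)))"
    using ob'(6) oc(1) by (simp add: ob1_def Max_insert_max)
  moreover have "agents ob' = agents ob + (\<Sum>c\<leftarrow>c # cs. agents (the (M c)))"
    using ob'(7) oc(1) by (simp add: ob1_def)
  moreover have "otime ob' = otime ob"
    using ob'(5) by (simp add: ob1_def)
  ultimately show ?case
    using ob'(2-4) by blast
qed

lemma sand_collect_succeeded:
  assumes "kind ob = KSand" and "status ob = Unknown" and "pend ob = ps @ rest" and "p \<notin> set ps"
    and "\<forall>c\<in>set ps. \<exists>oc. M c = Some oc \<and> status oc = Succeed"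
  shows "\<exists>ob'. Conf r (M(p \<mapsto> ob)) \<rightarrow>\<^sup>* Conf r (M(p \<mapsto> ob'))
    \<and> kind ob' = KSand \<and> status ob' = Unknown \<and> pend ob' = rest \<and> otime ob' = otime ob
    \<and> acctime ob' = acctime ob + (\<Sum>c\<leftarrow>ps. acctime (the (M c)))
    \<and> agents ob \<le> agents ob' \<and> (\<forall>c\<in>set ps. agents (the (M c)) \<le> agents ob')"
  using assms
proof (induction ps arbitrary: ob)
  case Nil
  then show ?case by (intro exI[of _ ob]) auto
next
  case (Cons c cs)
  obtain oc where oc: "M c = Some oc" "status oc = Succeed" "c \<noteq> p"
    using Cons.prems by auto
  define ob1 where "ob1 = ob\<lparr>pend := cs @ rest, used := used ob \<union> {c},
    acctime := acctime ob + acctime oc, acccost := acccost ob + acccost oc,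
    agents := max (agents ob) (agents oc)\<rparr>"
  have step1: "step (Conf r (M(p \<mapsto> ob))) (Conf r (M(p \<mapsto> ob1)))"
    using sand_child[of "M(p \<mapsto> ob)" p ob c "cs @ rest" oc r] oc Cons.prems by (simp add: ob1_def)
  have "\<exists>ob'. Conf r (M(p \<mapsto> ob1)) \<rightarrow>\<^sup>* Conf r (M(p \<mapsto> ob'))
      \<and> kind ob' = KSand \<and> status ob' = Unknown \<and> pend ob' = rest \<and> otime ob' = otime ob1
      \<and> acctime ob' = acctime ob1 + (\<Sum>c\<leftarrow>cs. acctime (the (M c)))
      \<and> agents ob1 \<le> agents ob' \<and> (\<forall>c\<in>set cs. agents (the (M c)) \<le> agents ob')"
    by (rule Cons.IH) (use Cons.prems in \<open>simp_all add: ob1_def\<close>)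
  then obtain ob' where ob': "Conf r (M(p \<mapsto> ob1)) \<rightarrow>\<^sup>* Conf r (M(p \<mapsto> ob'))"
    "kind ob' = KSand" "status ob' = Unknown" "pend ob' = rest" "otime ob' = otime ob1"
    "acctime ob' = acctime ob1 + (\<Sum>c\<leftarrow>cs. acctime (the (M c)))"
    "agents ob1 \<le> agents ob'" "\<forall>c\<in>set cs. agents (the (M c)) \<le> agents ob'"
    by blast
  have "Conf r (M(p \<mapsto> ob)) \<rightarrow>\<^sup>* Conf r (M(p \<mapsto> ob'))"
    using step1 ob'(1) by (rule converse_rtranclp_into_rtranclp)
  moreover have "acctime ob' = acctime ob + (\<Sum>c\<leftarrow>c # cs. acctime (the (M c)))"
    using ob'(6) oc(1) by (simp add: ob1_def)
  moreover have "agents ob \<le> agents ob'" "\<forall>c'\<in>set (c # cs). agents (the (M c')) \<le> agents ob'"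
    using ob'(7,8) oc(1) by (simp_all add: ob1_def)
  moreover have "otime ob' = otime ob"
    using ob'(5) by (simp add: ob1_def)
  ultimately show ?case
    using ob'(2-4) by blast
qed

lemma run_then_step:
  assumes "M p = Some ob0" and "Conf r (M(p \<mapsto> ob0)) \<rightarrow>\<^sup>* Conf r (M(p \<mapsto> ob))"
    and "step (Conf r (M(p \<mapsto> ob))) (Conf r ((M(p \<mapsto> ob))(p \<mapsto> ob')))"
  shows "Conf r M \<rightarrow>\<^sup>* Conf r (M(p \<mapsto> ob'))"
proof -
  have "M(p \<mapsto> ob0) = M"
    using assms(1) by (simp add: fun_upd_idem)
  then show ?thesis
    using rtranclp.rtrancl_into_rtrancl[OF assms(2,3)] by simp
qed

lemma or_gate_succeeds:
  assumes "M p = Some (init_obj p (OrG g c cs))" and "i < length cs"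
    and "M (p @ [i]) = Some oc" and "status oc = Succeed"
  shows "\<exists>ob. Conf r M \<rightarrow>\<^sup>* Conf r (M(p \<mapsto> ob))
    \<and> status ob = Succeed \<and> acctime ob = g + acctime oc \<and> agents ob = agents oc"
proof -
  define ob where "ob = (init_obj p (OrG g c cs))\<lparr>status := Succeed, pend := [],
    used := used (init_obj p (OrG g c cs)) \<union> {p @ [i]}, acctime := g + acctime oc,
    acccost := c + acccost oc, agents := agents oc\<rparr>"
  have "step (Conf r M) (Conf r (M(p \<mapsto> ob)))"
    using or_succ[of M p "init_obj p (OrG g c cs)" "p @ [i]" oc r] assms by (simp add: ob_def)
  then show ?thesis
    by (intro exI[of _ ob]) (simp add: ob_def)
qed

lemma or_gate_fails:
  assumes "M p = Some (init_obj p (OrG g c cs))"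
    and "\<forall>i<length cs. M (p @ [i]) = Some (oc i) \<and> status (oc i) = Fail"
  shows "\<exists>ob. Conf r M \<rightarrow>\<^sup>* Conf r (M(p \<mapsto> ob)) \<and> status ob = Fail"
proof -
  let ?ob0 = "init_obj p (OrG g c cs)"
  have pre: "kind ?ob0 = KOr" "status ?ob0 = Unknown" "distinct (pend ?ob0)" "p \<notin> set (pend ?ob0)"
    "\<forall>c\<in>set (pend ?ob0). \<exists>oc. M c = Some oc \<and> status oc = Fail"
    using assms(2) by (auto simp: distinct_child_positions)
  obtain ob where ob: "Conf r (M(p \<mapsto> ?ob0)) \<rightarrow>\<^sup>* Conf r (M(p \<mapsto> ob))"
    "kind ob = KOr" "status ob = Unknown" "pend ob = []"
    using or_drop_failed[OF pre(1,2) refl pre(3-5)] by blast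
  have "step (Conf r (M(p \<mapsto> ob))) (Conf r ((M(p \<mapsto> ob))(p \<mapsto> ob\<lparr>status := Fail\<rparr>)))"
    by (rule or_fail) (use ob in simp_all)
  then have "Conf r M \<rightarrow>\<^sup>* Conf r (M(p \<mapsto> ob\<lparr>status := Fail\<rparr>))"
    by (rule run_then_step[OF assms(1) ob(1)])
  then show ?thesis by (intro exI[of _ "ob\<lparr>status := Fail\<rparr>"]) simp
qed

lemma and_gate_fails:
  assumes "M p = Some (init_obj p (AndG g c cs))" and "i < length cs"
    and "M (p @ [i]) = Some oc" and "status oc = Fail"
  shows "\<exists>ob. Conf r M \<rightarrow>\<^sup>* Conf r (M(p \<mapsto> ob)) \<and> status ob = Fail"
proof -
  have "step (Conf r M) (Conf r (M(p \<mapsto> (init_obj p (AndG g c cs))\<lparr>status := Fail\<rparr>)))"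
    using and_fail[of M p "init_obj p (AndG g c cs)" "p @ [i]" oc r] assms by simp
  then show ?thesis by auto
qed

lemma and_gate_succeeds:
  assumes "M p = Some (init_obj p (AndG g c cs))"
    and "\<forall>i<length cs. M (p @ [i]) = Some (oc i) \<and> status (oc i) = Succeed"
  shows "\<exists>ob. Conf r M \<rightarrow>\<^sup>* Conf r (M(p \<mapsto> ob)) \<and> status ob = Succeed
    \<and> acctime ob = Max (insert 0 ((\<lambda>i. acctime (oc i)) ` {..<length cs})) + g
    \<and> agents ob = (\<Sum>i<length cs. agents (oc i))"
proof -
  let ?ob0 = "init_obj p (AndG g c cs)"
  have pre: "kind ?ob0 = KAnd" "status ?ob0 = Unknown" "distinct (pend ?ob0)" "p \<notin> set (pend ?ob0)"
    "\<forall>c\<in>set (pend ?ob0). \<exists>oc. M c = Some oc \<and> status oc = Succeed"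
    using assms(2) by (auto simp: distinct_child_positions)
  obtain ob where ob: "Conf r (M(p \<mapsto> ?ob0)) \<rightarrow>\<^sup>* Conf r (M(p \<mapsto> ob))"
    "kind ob = KAnd" "status ob = Unknown" "pend ob = []" "otime ob = otime ?ob0"
    "acctime ob = Max (insert (acctime ?ob0) ((\<lambda>c. acctime (the (M c))) ` set (pend ?ob0)))"
    "agents ob = agents ?ob0 + (\<Sum>c\<leftarrow>pend ?ob0. agents (the (M c)))"
    using and_collect_succeeded[OF pre(1,2) refl pre(3-5)] by blast
  define ob' where "ob' = ob\<lparr>status := Succeed,
    acctime := acctime ob + otime ob, acccost := acccost ob + ocost ob\<rparr>"
  have child: "the (M (p @ [i])) = oc i" if "i < length cs" for i
    using assms(2) that by simp
  have "step (Conf r (M(p \<mapsto> ob))) (Conf r ((M(p \<mapsto> ob))(p \<mapsto> ob')))"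
    unfolding ob'_def by (rule and_succ) (use ob in simp_all)
  then have "Conf r M \<rightarrow>\<^sup>* Conf r (M(p \<mapsto> ob'))"
    by (rule run_then_step[OF assms(1) ob(1)])
  moreover have "(\<lambda>c. acctime (the (M c))) ` set (pend ?ob0)
      = (\<lambda>i. acctime (the (M (p @ [i])))) ` {..<length cs}"
    by (simp add: image_image atLeast0LessThan)
  moreover have "\<dots> = (\<lambda>i. acctime (oc i)) ` {..<length cs}"
    by (rule image_cong) (simp_all add: child)
  moreover have "(\<Sum>c\<leftarrow>pend ?ob0. agents (the (M c))) = (\<Sum>i<length cs. agents (the (M (p @ [i]))))"
    by (simp add: interv_sum_list_conv_sum_set_nat atLeast0LessThan)
  moreover have "\<dots> = (\<Sum>i<length cs. agents (oc i))"
    by (rule sum.cong) (simp_all add: child)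
  ultimately show ?thesis
    using ob(5-7) by (intro exI[of _ ob']) (simp add: ob'_def)
qed

lemma sand_gate_succeeds:
  assumes "M p = Some (init_obj p (SandG g c cs))"
    and "\<forall>i<length cs. M (p @ [i]) = Some (oc i) \<and> status (oc i) = Succeed"
  shows "\<exists>ob. Conf r M \<rightarrow>\<^sup>* Conf r (M(p \<mapsto> ob)) \<and> status ob = Succeed
    \<and> acctime ob = (\<Sum>i<length cs. acctime (oc i)) + g
    \<and> (\<forall>i<length cs. agents (oc i) \<le> agents ob)"
proof -
  let ?ob0 = "init_obj p (SandG g c cs)"
  have pre: "kind ?ob0 = KSand" "status ?ob0 = Unknown" "pend ?ob0 = pend ?ob0 @ []" "p \<notin> set (pend ?ob0)"
    "\<forall>c\<in>set (pend ?ob0). \<exists>oc. M c = Some oc \<and> status oc = Succeed"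
    using assms(2) by auto
  obtain ob where ob: "Conf r (M(p \<mapsto> ?ob0)) \<rightarrow>\<^sup>* Conf r (M(p \<mapsto> ob))"
    "kind ob = KSand" "status ob = Unknown" "pend ob = []" "otime ob = otime ?ob0"
    "acctime ob = acctime ?ob0 + (\<Sum>c\<leftarrow>pend ?ob0. acctime (the (M c)))"
    "\<forall>c\<in>set (pend ?ob0). agents (the (M c)) \<le> agents ob"
    using sand_collect_succeeded[OF pre] by blast
  define ob' where "ob' = ob\<lparr>status := Succeed,
    acctime := acctime ob + otime ob, acccost := acccost ob + ocost ob\<rparr>"
  have child: "the (M (p @ [i])) = oc i" if "i < length cs" for i
    using assms(2) that by simp
  have "step (Conf r (M(p \<mapsto> ob))) (Conf r ((M(p \<mapsto> ob))(p \<mapsto> ob')))"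
    unfolding ob'_def by (rule sand_succ) (use ob in simp_all)
  then have "Conf r M \<rightarrow>\<^sup>* Conf r (M(p \<mapsto> ob'))"
    by (rule run_then_step[OF assms(1) ob(1)])
  moreover have "(\<Sum>c\<leftarrow>pend ?ob0. acctime (the (M c))) = (\<Sum>i<length cs. acctime (the (M (p @ [i]))))"
    by (simp add: interv_sum_list_conv_sum_set_nat atLeast0LessThan)
  moreover have "\<dots> = (\<Sum>i<length cs. acctime (oc i))"
    by (rule sum.cong) (simp_all add: child)
  moreover have "\<forall>i<length cs. agents (oc i) \<le> agents ob"
    using ob(7) child by auto
  ultimately show ?thesis
    using ob(5,6) by (intro exI[of _ ob']) (simp add: ob'_def)
qed

lemma sand_gate_fails:
  assumes "M p = Some (init_obj p (SandG g c cs))" and "j < length cs"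
    and "\<forall>i<j. M (p @ [i]) = Some (oc i) \<and> status (oc i) = Succeed"
    and "M (p @ [j]) = Some (oc j)" and "status (oc j) = Fail"
  shows "\<exists>ob. Conf r M \<rightarrow>\<^sup>* Conf r (M(p \<mapsto> ob)) \<and> status ob = Fail"
proof -
  let ?ob0 = "init_obj p (SandG g c cs)"
  let ?rest = "(p @ [j]) # map (\<lambda>i. p @ [i]) [Suc j..<length cs]"
  have "[0..<length cs] = [0..<j] @ [j..<length cs]"
    using upt_add_eq_append[of 0 j "length cs - j"] assms(2) by simp
  also have "[j..<length cs] = j # [Suc j..<length cs]"
    using assms(2) by (simp add: upt_conv_Cons)
  finally have "pend ?ob0 = map (\<lambda>i. p @ [i]) [0..<j] @ ?rest"
    by simp
  moreover have "\<forall>c\<in>set (map (\<lambda>i. p @ [i]) [0..<j]). \<exists>oc. M c = Some oc \<and> status oc = Succeed"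
    using assms(3) by auto
  ultimately have pre: "kind ?ob0 = KSand" "status ?ob0 = Unknown"
    "pend ?ob0 = map (\<lambda>i. p @ [i]) [0..<j] @ ?rest" "p \<notin> set (map (\<lambda>i. p @ [i]) [0..<j])"
    "\<forall>c\<in>set (map (\<lambda>i. p @ [i]) [0..<j]). \<exists>oc. M c = Some oc \<and> status oc = Succeed"
    by (simp_all add: image_iff)
  obtain ob where ob: "Conf r (M(p \<mapsto> ?ob0)) \<rightarrow>\<^sup>* Conf r (M(p \<mapsto> ob))"
    "kind ob = KSand" "status ob = Unknown" "pend ob = ?rest"
    using sand_collect_succeeded[OF pre] by blast
  have "step (Conf r (M(p \<mapsto> ob))) (Conf r ((M(p \<mapsto> ob))(p \<mapsto> ob\<lparr>status := Fail\<rparr>)))"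
    by (rule sand_fail[where c = "p @ [j]" and oc = "oc j"]) (use ob assms(4,5) in simp_all)
  then have "Conf r M \<rightarrow>\<^sup>* Conf r (M(p \<mapsto> ob\<lparr>status := Fail\<rparr>))"
    by (rule run_then_step[OF assms(1) ob(1)])
  then show ?thesis by (intro exI[of _ "ob\<lparr>status := Fail\<rparr>"]) simp
qed

lemma not_gate_succeeds:
  assumes "M p = Some (init_obj p (NotG g c t))" and "M (p @ [0]) = Some oc" and "status oc = Fail"
  shows "\<exists>ob. Conf r M \<rightarrow>\<^sup>* Conf r (M(p \<mapsto> ob)) \<and> status ob = Succeed \<and> acctime ob = g \<and> agents ob = 0"
proof -
  have "step (Conf r M) (Conf r (M(p \<mapsto> (init_obj p (NotG g c t))\<lparr>status := Succeed,
      acctime := g, acccost := c\<rparr>)))"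
    using not_succ[of M p "init_obj p (NotG g c t)" "p @ [0]" oc r] assms by simp
  then show ?thesis by auto
qed

lemma not_gate_fails:
  assumes "M p = Some (init_obj p (NotG g c t))" and "M (p @ [0]) = Some oc" and "status oc = Succeed"
  shows "\<exists>ob. Conf r M \<rightarrow>\<^sup>* Conf r (M(p \<mapsto> ob)) \<and> status ob = Fail"
proof -
  have "step (Conf r M) (Conf r (M(p \<mapsto> (init_obj p (NotG g c t))\<lparr>status := Fail\<rparr>)))"
    using not_fail[of M p "init_obj p (NotG g c t)" "p @ [0]" oc r] assms by simp
  then show ?thesis by auto
qed

section \<open>Replaying the outcome of a tree\<close>

definition realises_outcome :: "adt \<Rightarrow> (pos \<Rightarrow> bool) \<Rightarrow> pos \<Rightarrow> bool" where
  "realises_outcome T out p \<longleftrightarrow> (\<forall>M. encodes_at T p M \<longrightarrow>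
     (sat T out p \<longrightarrow> reaches_at p M (\<lambda>ob. status ob = Succeed)) \<and>
     (unsat T out p \<longrightarrow> reaches_at p M (\<lambda>ob. status ob = Fail)))"

lemma realises_outcome_sat:
  "realises_outcome T out p \<Longrightarrow> encodes_at T p M \<Longrightarrow> sat T out p
    \<Longrightarrow> reaches_at p M (\<lambda>ob. status ob = Succeed)"
  unfolding realises_outcome_def by blast

lemma realises_outcome_unsat:
  "realises_outcome T out p \<Longrightarrow> encodes_at T p M \<Longrightarrow> unsat T out p
    \<Longrightarrow> reaches_at p M (\<lambda>ob. status ob = Fail)"
  unfolding realises_outcome_def by blast

lemma leaf_realises_outcome:
  assumes "T = ALeaf tm c \<or> T = DLeaf"
  shows "realises_outcome T out p"
  unfolding realises_outcome_def
proof (intro allI impI conjI)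
  fix M assume "encodes_at T p M"
  then have root: "M p = Some (init_obj p T)" by (rule encodes_at_root)
  have leaf: "kind (init_obj p T) \<in> {KAtk, KDef}" "status (init_obj p T) = Unknown"
    using assms by auto
  show "reaches_at p M (\<lambda>ob. status ob = Succeed)"
    by (rule reaches_at_mono[OF leaf_reaches(1)[of M p "init_obj p T", OF root leaf]]) simp
  show "reaches_at p M (\<lambda>ob. status ob = Fail)"
    by (rule leaf_reaches(2)[of M p "init_obj p T", OF root leaf])
qed

lemma or_realises_outcome:
  assumes "\<forall>i<length cs. realises_outcome (cs ! i) out (p @ [i])"
  shows "realises_outcome (OrG g c cs) out p"
  unfolding realises_outcome_def
proof (intro allI impI conjI)
  fix M assume enc: "encodes_at (OrG g c cs) p M"
  show "reaches_at p M (\<lambda>ob. status ob = Succeed)" if gate: "sat (OrG g c cs) out p"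
  proof -
    obtain i where i: "i < length cs" "sat (cs ! i) out (p @ [i])"
      using gate by (blast elim: sat_OrE)
    have "\<exists>M1 oc. run_within p M M1 \<and> M1 p = Some (init_obj p (OrG g c cs))
        \<and> (\<forall>k\<in>{i}. M1 (p @ [k]) = Some (oc k) \<and> status (oc k) = Succeed)"
    proof (rule children_reach[OF enc, where ts = "nth cs" and Q = "\<lambda>_ ob. status ob = Succeed"])
      fix k M' assume "k \<in> {i}" "encodes_at (cs ! k) (p @ [k]) M'"
      then show "reaches_at (p @ [k]) M' (\<lambda>ob. status ob = Succeed)"
        using i assms realises_outcome_sat by blast
    qed (use i in simp_all)
    then obtain M1 oc where M1: "run_within p M M1" "M1 p = Some (init_obj p (OrG g c cs))"
      "M1 (p @ [i]) = Some (oc i)" "status (oc i) = Succeed"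
      by blast
    obtain ob where "Conf r M1 \<rightarrow>\<^sup>* Conf r (M1(p \<mapsto> ob))" "status ob = Succeed"
      using or_gate_succeeds[OF M1(2) i(1) M1(3,4)] by blast
    then show ?thesis by (rule reaches_at_update[OF M1(1)])
  qed
  show "reaches_at p M (\<lambda>ob. status ob = Fail)" if gate: "unsat (OrG g c cs) out p"
  proof -
    have unsat: "\<forall>i<length cs. unsat (cs ! i) out (p @ [i])"
      using gate by (blast elim: unsat_OrE)
    have "\<exists>M1 oc. run_within p M M1 \<and> M1 p = Some (init_obj p (OrG g c cs))
        \<and> (\<forall>k\<in>{..<length cs}. M1 (p @ [k]) = Some (oc k) \<and> status (oc k) = Fail)"
    proof (rule children_reach[OF enc, where ts = "nth cs" and Q = "\<lambda>_ ob. status ob = Fail"])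
      fix k M' assume "k \<in> {..<length cs}" "encodes_at (cs ! k) (p @ [k]) M'"
      then show "reaches_at (p @ [k]) M' (\<lambda>ob. status ob = Fail)"
        using unsat assms realises_outcome_unsat by blast
    qed simp_all
    then obtain M1 oc where M1: "run_within p M M1" "M1 p = Some (init_obj p (OrG g c cs))"
      "\<forall>k<length cs. M1 (p @ [k]) = Some (oc k) \<and> status (oc k) = Fail"
      by auto
    obtain ob where "Conf r M1 \<rightarrow>\<^sup>* Conf r (M1(p \<mapsto> ob))" "status ob = Fail"
      using or_gate_fails[OF M1(2,3)] by blast
    then show ?thesis by (rule reaches_at_update[OF M1(1)])
  qed
qed

lemma and_realises_outcome:
  assumes "\<forall>i<length cs. realises_outcome (cs ! i) out (p @ [i])"
  shows "realises_outcome (AndG g c cs) out p"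
  unfolding realises_outcome_def
proof (intro allI impI conjI)
  fix M assume enc: "encodes_at (AndG g c cs) p M"
  show "reaches_at p M (\<lambda>ob. status ob = Succeed)" if gate: "sat (AndG g c cs) out p"
  proof -
    have sat: "\<forall>i<length cs. sat (cs ! i) out (p @ [i])"
      using gate by (blast elim: sat_AndE)
    have "\<exists>M1 oc. run_within p M M1 \<and> M1 p = Some (init_obj p (AndG g c cs))
        \<and> (\<forall>k\<in>{..<length cs}. M1 (p @ [k]) = Some (oc k) \<and> status (oc k) = Succeed)"
    proof (rule children_reach[OF enc, where ts = "nth cs" and Q = "\<lambda>_ ob. status ob = Succeed"])
      fix k M' assume "k \<in> {..<length cs}" "encodes_at (cs ! k) (p @ [k]) M'"
      then show "reaches_at (p @ [k]) M' (\<lambda>ob. status ob = Succeed)"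
        using sat assms realises_outcome_sat by blast
    qed simp_all
    then obtain M1 oc where M1: "run_within p M M1" "M1 p = Some (init_obj p (AndG g c cs))"
      "\<forall>k<length cs. M1 (p @ [k]) = Some (oc k) \<and> status (oc k) = Succeed"
      by auto
    obtain ob where "Conf r M1 \<rightarrow>\<^sup>* Conf r (M1(p \<mapsto> ob))" "status ob = Succeed"
      using and_gate_succeeds[OF M1(2,3)] by blast
    then show ?thesis by (rule reaches_at_update[OF M1(1)])
  qed
  show "reaches_at p M (\<lambda>ob. status ob = Fail)" if gate: "unsat (AndG g c cs) out p"
  proof -
    obtain i where i: "i < length cs" "unsat (cs ! i) out (p @ [i])"
      using gate by (blast elim: unsat_AndE)
    have "\<exists>M1 oc. run_within p M M1 \<and> M1 p = Some (init_obj p (AndG g c cs))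
        \<and> (\<forall>k\<in>{i}. M1 (p @ [k]) = Some (oc k) \<and> status (oc k) = Fail)"
    proof (rule children_reach[OF enc, where ts = "nth cs" and Q = "\<lambda>_ ob. status ob = Fail"])
      fix k M' assume "k \<in> {i}" "encodes_at (cs ! k) (p @ [k]) M'"
      then show "reaches_at (p @ [k]) M' (\<lambda>ob. status ob = Fail)"
        using i assms realises_outcome_unsat by blast
    qed (use i in simp_all)
    then obtain M1 oc where M1: "run_within p M M1" "M1 p = Some (init_obj p (AndG g c cs))"
      "M1 (p @ [i]) = Some (oc i)" "status (oc i) = Fail"
      by blast
    obtain ob where "Conf r M1 \<rightarrow>\<^sup>* Conf r (M1(p \<mapsto> ob))" "status ob = Fail"
      using and_gate_fails[OF M1(2) i(1) M1(3,4)] by blast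
    then show ?thesis by (rule reaches_at_update[OF M1(1)])
  qed
qed

lemma sand_unsat_reaches_Fail:
  assumes "\<forall>i<length cs. realises_outcome (cs ! i) out (p @ [i])"
    and enc: "encodes_at (SandG g c cs) p M" and "unsat (SandG g c cs) out p"
  shows "reaches_at p M (\<lambda>ob. status ob = Fail)"
proof -
  obtain j where j: "j < length cs" "unsat (cs ! j) out (p @ [j])"
    and before: "\<forall>i<j. sat (cs ! i) out (p @ [i])"
    using assms(3) by (rule unsat_SandE_first)
  let ?Q = "\<lambda>i ob. status ob = (if i < j then Succeed else Fail)"
  have "\<exists>M1 oc. run_within p M M1 \<and> M1 p = Some (init_obj p (SandG g c cs))
      \<and> (\<forall>k\<in>{..j}. M1 (p @ [k]) = Some (oc k) \<and> ?Q k (oc k))"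
  proof (rule children_reach[OF enc, where ts = "nth cs"])
    fix k M' assume k: "k \<in> {..j}" and "encodes_at (cs ! k) (p @ [k]) M'"
    moreover have "realises_outcome (cs ! k) out (p @ [k])"
      using assms j(1) k by simp
    ultimately show "reaches_at (p @ [k]) M' (?Q k)"
      using before j(2) realises_outcome_sat realises_outcome_unsat
      by (cases "k < j") (simp_all add: le_less)
  qed (use j in simp_all)
  then obtain M1 oc where M1: "run_within p M M1" "M1 p = Some (init_obj p (SandG g c cs))"
    "\<forall>k\<in>{..j}. M1 (p @ [k]) = Some (oc k) \<and> ?Q k (oc k)"
    by blast
  then have children: "\<forall>k<j. M1 (p @ [k]) = Some (oc k) \<and> status (oc k) = Succeed"
    "M1 (p @ [j]) = Some (oc j)" "status (oc j) = Fail"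
    by auto
  obtain ob where "Conf r M1 \<rightarrow>\<^sup>* Conf r (M1(p \<mapsto> ob))" "status ob = Fail"
    using sand_gate_fails[OF M1(2) j(1) children] by blast
  then show ?thesis by (rule reaches_at_update[OF M1(1)])
qed

lemma sand_realises_outcome:
  assumes "\<forall>i<length cs. realises_outcome (cs ! i) out (p @ [i])"
  shows "realises_outcome (SandG g c cs) out p"
  unfolding realises_outcome_def
proof (intro allI impI conjI)
  fix M assume enc: "encodes_at (SandG g c cs) p M"
  show "reaches_at p M (\<lambda>ob. status ob = Succeed)" if gate: "sat (SandG g c cs) out p"
  proof -
    have sat: "\<forall>i<length cs. sat (cs ! i) out (p @ [i])"
      using gate by (blast elim: sat_SandE)
    have "\<exists>M1 oc. run_within p M M1 \<and> M1 p = Some (init_obj p (SandG g c cs))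
        \<and> (\<forall>k\<in>{..<length cs}. M1 (p @ [k]) = Some (oc k) \<and> status (oc k) = Succeed)"
    proof (rule children_reach[OF enc, where ts = "nth cs" and Q = "\<lambda>_ ob. status ob = Succeed"])
      fix k M' assume "k \<in> {..<length cs}" "encodes_at (cs ! k) (p @ [k]) M'"
      then show "reaches_at (p @ [k]) M' (\<lambda>ob. status ob = Succeed)"
        using sat assms realises_outcome_sat by blast
    qed simp_all
    then obtain M1 oc where M1: "run_within p M M1" "M1 p = Some (init_obj p (SandG g c cs))"
      "\<forall>k<length cs. M1 (p @ [k]) = Some (oc k) \<and> status (oc k) = Succeed"
      by auto
    obtain ob where "Conf r M1 \<rightarrow>\<^sup>* Conf r (M1(p \<mapsto> ob))" "status ob = Succeed"
      using sand_gate_succeeds[OF M1(2,3)] by blast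
    then show ?thesis by (rule reaches_at_update[OF M1(1)])
  qed
  show "reaches_at p M (\<lambda>ob. status ob = Fail)" if "unsat (SandG g c cs) out p"
    using assms enc that by (rule sand_unsat_reaches_Fail)
qed

lemma not_realises_outcome:
  assumes "realises_outcome t out (p @ [0])"
  shows "realises_outcome (NotG g c t) out p"
  unfolding realises_outcome_def
proof (intro allI impI conjI)
  fix M assume enc: "encodes_at (NotG g c t) p M"
  have child: "node_at (NotG g c t) [0] = Some t" by simp
  show "reaches_at p M (\<lambda>ob. status ob = Succeed)" if gate: "sat (NotG g c t) out p"
  proof -
    have "\<exists>M1 oc. run_within p M M1 \<and> M1 p = Some (init_obj p (NotG g c t))
        \<and> (\<forall>k\<in>{0}. M1 (p @ [k]) = Some (oc k) \<and> status (oc k) = Fail)"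
    proof (rule children_reach[OF enc, where ts = "\<lambda>_. t" and Q = "\<lambda>_ ob. status ob = Fail"])
      fix k M' assume "k \<in> {0}" "encodes_at t (p @ [k]) M'"
      then show "reaches_at (p @ [k]) M' (\<lambda>ob. status ob = Fail)"
        using gate assms realises_outcome_unsat by (blast elim: sat_NotE)
    qed simp_all
    then obtain M1 oc where M1: "run_within p M M1" "M1 p = Some (init_obj p (NotG g c t))"
      "M1 (p @ [0]) = Some (oc 0)" "status (oc 0) = Fail"
      by auto
    obtain ob where "Conf r M1 \<rightarrow>\<^sup>* Conf r (M1(p \<mapsto> ob))" "status ob = Succeed"
      using not_gate_succeeds[OF M1(2-4)] by blast
    then show ?thesis by (rule reaches_at_update[OF M1(1)])
  qed
  show "reaches_at p M (\<lambda>ob. status ob = Fail)" if gate: "unsat (NotG g c t) out p"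
  proof -
    have "\<exists>M1 oc. run_within p M M1 \<and> M1 p = Some (init_obj p (NotG g c t))
        \<and> (\<forall>k\<in>{0}. M1 (p @ [k]) = Some (oc k) \<and> status (oc k) = Succeed)"
    proof (rule children_reach[OF enc, where ts = "\<lambda>_. t" and Q = "\<lambda>_ ob. status ob = Succeed"])
      fix k M' assume "k \<in> {0}" "encodes_at t (p @ [k]) M'"
      then show "reaches_at (p @ [k]) M' (\<lambda>ob. status ob = Succeed)"
        using gate assms realises_outcome_sat by (blast elim: unsat_NotE)
    qed simp_all
    then obtain M1 oc where M1: "run_within p M M1" "M1 p = Some (init_obj p (NotG g c t))"
      "M1 (p @ [0]) = Some (oc 0)" "status (oc 0) = Succeed"
      by auto
    obtain ob where "Conf r M1 \<rightarrow>\<^sup>* Conf r (M1(p \<mapsto> ob))" "status ob = Fail"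
      using not_gate_fails[OF M1(2-4)] by blast
    then show ?thesis by (rule reaches_at_update[OF M1(1)])
  qed
qed

lemma realises_outcome: "realises_outcome T out p"
proof (induction T arbitrary: p)
  case (OrG g c cs)
  then show ?case by (simp add: or_realises_outcome)
next
  case (AndG g c cs)
  then show ?case by (simp add: and_realises_outcome)
next
  case (SandG g c cs)
  then show ?case by (simp add: sand_realises_outcome)
next
  case (NotG g c t)
  then show ?case by (rule not_realises_outcome)
qed (simp_all add: leaf_realises_outcome)

section \<open>Replaying an attack\<close>

definition realises_attack :: "adt \<Rightarrow> pos \<Rightarrow> nat \<Rightarrow> (pos \<times> nat \<times> nat) set \<Rightarrow> nat \<Rightarrow> bool" where
  "realises_attack T p s J f \<longleftrightarrow> (\<forall>M. encodes_at T p M \<longrightarrow>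
     reaches_at p M (\<lambda>ob. status ob = Succeed \<and> s + acctime ob = f \<and> fits J (agents ob)))"

lemma realises_attackD:
  "realises_attack T p s J f \<Longrightarrow> encodes_at T p M
    \<Longrightarrow> reaches_at p M (\<lambda>ob. status ob = Succeed \<and> s + acctime ob = f \<and> fits J (agents ob))"
  unfolding realises_attack_def by blast

lemma attack_leaf_realises_attack: "realises_attack (ALeaf tm c) p s {(p, s, s + tm)} (s + tm)"
  unfolding realises_attack_def
proof (intro allI impI)
  fix M assume "encodes_at (ALeaf tm c) p M"
  then have root: "M p = Some (init_obj p (ALeaf tm c))" by (rule encodes_at_root)
  show "reaches_at p M (\<lambda>ob. status ob = Succeed \<and> s + acctime ob = s + tm \<and> fits {(p, s, s + tm)} (agents ob))"
    by (rule reaches_at_mono[OF leaf_reaches(1)[of M p "init_obj p (ALeaf tm c)", OF root]])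
      (auto intro: fits_singleton[unfolded One_nat_def])
qed

lemma defence_leaf_realises_attack: "realises_attack DLeaf p s {} s"
  unfolding realises_attack_def
proof (intro allI impI)
  fix M assume "encodes_at DLeaf p M"
  then have root: "M p = Some (init_obj p DLeaf)" by (rule encodes_at_root)
  show "reaches_at p M (\<lambda>ob. status ob = Succeed \<and> s + acctime ob = s \<and> fits {} (agents ob))"
    by (rule reaches_at_mono[OF leaf_reaches(1)[of M p "init_obj p DLeaf", OF root]])
      (simp_all add: fits_empty)
qed

lemma or_realises_attack:
  assumes "i < length cs" and "realises_attack (cs ! i) (p @ [i]) s J f"
  shows "realises_attack (OrG g c cs) p s J (f + g)"
  unfolding realises_attack_def
proof (intro allI impI)
  fix M assume enc: "encodes_at (OrG g c cs) p M"
  let ?Q = "\<lambda>ob. status ob = Succeed \<and> s + acctime ob = f \<and> fits J (agents ob)"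
  have "\<exists>M1 oc. run_within p M M1 \<and> M1 p = Some (init_obj p (OrG g c cs))
      \<and> (\<forall>k\<in>{i}. M1 (p @ [k]) = Some (oc k) \<and> ?Q (oc k))"
  proof (rule children_reach[OF enc, where ts = "nth cs" and Q = "\<lambda>_. ?Q"])
    fix k M' assume "k \<in> {i}" "encodes_at (cs ! k) (p @ [k]) M'"
    then show "reaches_at (p @ [k]) M' ?Q"
      using assms(2) realises_attackD by blast
  qed (use assms(1) in simp_all)
  then obtain M1 oc where M1: "run_within p M M1" "M1 p = Some (init_obj p (OrG g c cs))"
    "M1 (p @ [i]) = Some (oc i)" "?Q (oc i)"
    by blast
  obtain ob where "Conf r M1 \<rightarrow>\<^sup>* Conf r (M1(p \<mapsto> ob))" "status ob = Succeed"
    "acctime ob = g + acctime (oc i)" "agents ob = agents (oc i)"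
    using or_gate_succeeds[OF M1(2) assms(1) M1(3)] M1(4) by blast
  then show "reaches_at p M (\<lambda>ob. status ob = Succeed \<and> s + acctime ob = f + g \<and> fits J (agents ob))"
    using M1(4) by (intro reaches_at_update[OF M1(1)]) auto
qed

lemma and_realises_attack:
  assumes "\<forall>i<length cs. realises_attack (cs ! i) (p @ [i]) s (JJ i) (ff i)"
  shows "realises_attack (AndG g c cs) p s (\<Union>i<length cs. JJ i) (Max (insert s (ff ` {..<length cs})) + g)"
  unfolding realises_attack_def
proof (intro allI impI)
  fix M assume enc: "encodes_at (AndG g c cs) p M"
  let ?n = "length cs"
  let ?Q = "\<lambda>i ob. status ob = Succeed \<and> s + acctime ob = ff i \<and> fits (JJ i) (agents ob)"
  have "\<exists>M1 oc. run_within p M M1 \<and> M1 p = Some (init_obj p (AndG g c cs))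
      \<and> (\<forall>k\<in>{..<?n}. M1 (p @ [k]) = Some (oc k) \<and> ?Q k (oc k))"
  proof (rule children_reach[OF enc, where ts = "nth cs"])
    fix k M' assume "k \<in> {..<?n}" "encodes_at (cs ! k) (p @ [k]) M'"
    then show "reaches_at (p @ [k]) M' (?Q k)"
      using assms realises_attackD by blast
  qed simp_all
  then obtain M1 oc where M1: "run_within p M M1" "M1 p = Some (init_obj p (AndG g c cs))"
    "\<forall>k<?n. M1 (p @ [k]) = Some (oc k) \<and> ?Q k (oc k)"
    by auto
  have children: "\<forall>k<?n. M1 (p @ [k]) = Some (oc k) \<and> status (oc k) = Succeed"
    using M1(3) by blast
  obtain ob where ob: "Conf r M1 \<rightarrow>\<^sup>* Conf r (M1(p \<mapsto> ob))" "status ob = Succeed"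
    "acctime ob = Max (insert 0 ((\<lambda>i. acctime (oc i)) ` {..<?n})) + g"
    "agents ob = (\<Sum>i<?n. agents (oc i))"
    using and_gate_succeeds[where M = M1 and p = p, OF M1(2) children] by blast
  have "s + Max (insert 0 ((\<lambda>i. acctime (oc i)) ` {..<?n}))
      = Max ((+) s ` insert 0 ((\<lambda>i. acctime (oc i)) ` {..<?n}))"
    by (rule mono_Max_commute) (simp_all add: monoI)
  also have "\<dots> = Max (insert s ((\<lambda>i. s + acctime (oc i)) ` {..<?n}))"
    by (simp add: image_image)
  also have "(\<lambda>i. s + acctime (oc i)) ` {..<?n} = ff ` {..<?n}"
    by (rule image_cong) (use M1(3) in simp_all)
  finally have "s + acctime ob = Max (insert s (ff ` {..<?n})) + g"
    using ob(3) by simp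
  moreover have "fits (\<Union>i<?n. JJ i) (agents ob)"
    unfolding ob(4) by (rule fits_UN_sum) (use M1(3) in simp)
  ultimately show "reaches_at p M (\<lambda>ob. status ob = Succeed
      \<and> s + acctime ob = Max (insert s (ff ` {..<?n})) + g \<and> fits (\<Union>i<?n. JJ i) (agents ob))"
    using ob(2) by (intro reaches_at_update[OF M1(1) ob(1)]) simp
qed

lemma sand_realises_attack:
  assumes "st 0 = s"
    and reach: "\<forall>i<length cs. realises_attack (cs ! i) (p @ [i]) (st i) (JJ i) (st (Suc i))"
    and mono: "\<forall>i<length cs. st i \<le> st (Suc i)"
    and within: "\<forall>i<length cs. \<forall>j\<in>JJ i. st i \<le> start_time j \<and> finish_time j \<le> st (Suc i)"
  shows "realises_attack (SandG g c cs) p s (\<Union>i<length cs. JJ i) (st (length cs) + g)"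
  unfolding realises_attack_def
proof (intro allI impI)
  fix M assume enc: "encodes_at (SandG g c cs) p M"
  let ?n = "length cs"
  let ?Q = "\<lambda>i ob. status ob = Succeed \<and> st i + acctime ob = st (Suc i) \<and> fits (JJ i) (agents ob)"
  have "\<exists>M1 oc. run_within p M M1 \<and> M1 p = Some (init_obj p (SandG g c cs))
      \<and> (\<forall>k\<in>{..<?n}. M1 (p @ [k]) = Some (oc k) \<and> ?Q k (oc k))"
  proof (rule children_reach[OF enc, where ts = "nth cs"])
    fix k M' assume "k \<in> {..<?n}" "encodes_at (cs ! k) (p @ [k]) M'"
    then show "reaches_at (p @ [k]) M' (?Q k)"
      using reach realises_attackD by blast
  qed simp_all
  then obtain M1 oc where M1: "run_within p M M1" "M1 p = Some (init_obj p (SandG g c cs))"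
    "\<forall>k<?n. M1 (p @ [k]) = Some (oc k) \<and> ?Q k (oc k)"
    by auto
  have children: "\<forall>k<?n. M1 (p @ [k]) = Some (oc k) \<and> status (oc k) = Succeed"
    using M1(3) by blast
  obtain ob where ob: "Conf r M1 \<rightarrow>\<^sup>* Conf r (M1(p \<mapsto> ob))" "status ob = Succeed"
    "acctime ob = (\<Sum>i<?n. acctime (oc i)) + g" "\<forall>i<?n. agents (oc i) \<le> agents ob"
    using sand_gate_succeeds[where M = M1 and p = p, OF M1(2) children] by blast
  have "st ?n = st 0 + (\<Sum>i<?n. acctime (oc i))"
    by (rule sum_increments) (use M1(3) in simp)
  then have "s + acctime ob = st ?n + g"
    using assms(1) ob(3) by simp
  moreover have "fits (\<Union>i<?n. JJ i) (agents ob)"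
  proof (rule fits_UN_sequential)
    fix i assume "i < ?n"
    then show "fits (JJ i) (agents ob)"
      using M1(3) ob(4) fits_mono by blast
  next
    fix i k j j' assume ik: "i < k" "k < ?n" and j: "j \<in> JJ i" "j' \<in> JJ k"
    have "finish_time j \<le> st (Suc i)" "st k \<le> start_time j'"
      using within ik j by auto
    moreover have "st (Suc i) \<le> st k"
      by (rule lift_Suc_mono_le_ivl[of "{..<?n}"]) (use mono ik in auto)
    ultimately show "finish_time j \<le> start_time j'"
      by linarith
  qed
  ultimately show "reaches_at p M (\<lambda>ob. status ob = Succeed
      \<and> s + acctime ob = st ?n + g \<and> fits (\<Union>i<?n. JJ i) (agents ob))"
    using ob(2) by (intro reaches_at_update[OF M1(1) ob(1)]) simp
qed

lemma not_realises_attack: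
  assumes "unsat t out (p @ [0])"
  shows "realises_attack (NotG g c t) p s {} (s + g)"
  unfolding realises_attack_def
proof (intro allI impI)
  fix M assume enc: "encodes_at (NotG g c t) p M"
  have "\<exists>M1 oc. run_within p M M1 \<and> M1 p = Some (init_obj p (NotG g c t))
      \<and> (\<forall>k\<in>{0}. M1 (p @ [k]) = Some (oc k) \<and> status (oc k) = Fail)"
  proof (rule children_reach[OF enc, where ts = "\<lambda>_. t" and Q = "\<lambda>_ ob. status ob = Fail"])
    fix k M' assume "k \<in> {0}" "encodes_at t (p @ [k]) M'"
    then show "reaches_at (p @ [k]) M' (\<lambda>ob. status ob = Fail)"
      using assms realises_outcome realises_outcome_unsat by blast
  qed simp_all
  then obtain M1 oc where M1: "run_within p M M1" "M1 p = Some (init_obj p (NotG g c t))"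
    "M1 (p @ [0]) = Some (oc 0)" "status (oc 0) = Fail"
    by auto
  obtain ob where ob: "Conf r M1 \<rightarrow>\<^sup>* Conf r (M1(p \<mapsto> ob))" "status ob = Succeed"
    "acctime ob = g" "agents ob = 0"
    using not_gate_succeeds[OF M1(2-4)] by blast
  show "reaches_at p M (\<lambda>ob. status ob = Succeed \<and> s + acctime ob = s + g \<and> fits {} (agents ob))"
    using ob(2,3) fits_empty by (intro reaches_at_update[OF M1(1) ob(1)]) simp
qed

lemma exec_realises_attack: "exec T out p s J f \<Longrightarrow> realises_attack T p s J f"
proof (induction rule: exec.induct)
  case eA
  show ?case by (rule attack_leaf_realises_attack)
next
  case eD
  show ?case by (rule defence_leaf_realises_attack)
next
  case (eOr i cs out p s J f g c)
  show ?case by (rule or_realises_attack[OF eOr.hyps(1) eOr.IH])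
next
  case eAnd
  then show ?case by (intro and_realises_attack) blast
next
  case (eSand st s cs out p JJ g c)
  have "st i \<le> st (Suc i) \<and> (\<forall>j\<in>JJ i. st i \<le> start_time j \<and> finish_time j \<le> st (Suc i))"
    if "i < length cs" for i
    using eSand.IH that exec_interval by blast
  then show ?case
    using eSand by (intro sand_realises_attack) blast+
next
  case eNot
  then show ?case by (rule not_realises_attack)
qed

end

theorem theorem3:
  fixes T :: adt and n t :: nat
  assumes "can_perform T n t"
  shows "\<exists>a SA SD. encode T \<rightarrow>\<^sup>* Summary a t SA SD \<and> n \<le> a"
proof -
  obtain out J where exec: "exec T out [] 0 J t" and needs_n: "\<forall>m<n. \<not> fits J m"
    using assms unfolding can_perform_def by blast
  define M where "M = (\<lambda>p. map_option (init_obj p) (node_at T p))"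
  have "encodes_at T [] M"
    by (simp add: encodes_at_def M_def)
  then obtain M' ob where run: "Conf [] M \<rightarrow>\<^sup>* Conf [] M'"
    and ob: "M' [] = Some ob" "status ob = Succeed" "acctime ob = t" "fits J (agents ob)"
    using exec_realises_attack[where r = "[]", OF exec]
    unfolding realises_attack_def reaches_at_def run_within_def by auto
  have "encode T \<rightarrow>\<^sup>* Summary (agents ob) t (used_attacks [] M') (active_defences M')"
    using rtranclp.rtrancl_into_rtrancl[OF run finish[of M' "[]" ob, OF ob(1,2)]] ob(3)
    by (simp add: encode_def M_def)
  moreover have "n \<le> agents ob"
    using needs_n ob(4) not_le by blast
  ultimately show ?thesis by blast
qed

end
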